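(* Let $n=2$ and $\alpha\ge1$. Then: \begin{itemize} \item there exists $\mathbf x\in\mathcal T_D(\boldsymbol\sigma)$ with $R(\boldsymbol\rho,\mathbf x)\le\alpha$ if and only if there is no $\alpha$-deterministic conflict pair; \item there exists $\mathbf x\in\mathcal T(\boldsymbol\sigma)$ with $R_C(\boldsymbol\rho,\mathbf x)\le\alpha$ if and only if there is no $\alpha$-cost conflict pair; \item there exists $\mathbf x\in\mathcal T(\boldsymbol\sigma)$ with $R_V(\boldsymbol\rho,\mathbf x)\le\alpha$ if and only if there is no $\alpha$-value conflict pair. \end{itemize}
   Context: There are $n=2$ agents with signals $s_1,s_2\in[k]=\{1,\dots,k\}$; $\mathbf s=(s_1,s_2)$ and $\mathbf s_{-i}$ is the signal of the agent other than $i$. An instance is given by arbitrary value functions $v_1,v_2:[k]^2\to\mathbb R_{>0}$ or, equivalently, cost functions $c_i=1/v_i$. Performance ratios: $\rho_i(\mathbf s)=\frac{v_i(\mathbf s)}{\max_j v_j(\mathbf s)}=\frac{\min_j c_j(\mathbf s)}{c_i(\mathbf s)}\in(0,1]$. Signal orders: $\sigma_i(\mathbf s_{-i})=\{(s_i,s_i')\in[k]^2: v_i(s_i,\mathbf s_{-i})<v_i(s_i',\mathbf s_{-i})\}$. $\mathcal T(\boldsymbol\sigma)$ is the set of $\mathbf x=(x_i(\mathbf s))_{i\in[2],\mathbf s\in[k]^2}$ with $x_i(\mathbf s)\ge0$, $x_1(\mathbf s)+x_2(\mathbf s)=1$ for all $\mathbf s$, and $x_i(s_i,\mathbf s_{-i})\le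 x_i(s_i',\mathbf s_{-i})$ for all $i$, $\mathbf s_{-i}$ and $(s_i,s_i')\in\sigma_i(\mathbf s_{-i})$. $\mathcal T_D(\boldsymbol\sigma)$ is the subset of $\mathbf x$ with all $x_i(\mathbf s)\in\{0,1\}$. Ratios: $R_V(\boldsymbol\rho,\mathbf x)=\max_{\mathbf s}\frac1{\sum_i x_i(\mathbf s)\rho_i(\mathbf s)}$, $R_C(\boldsymbol\rho,\mathbf x)=\max_{\mathbf s}\sum_i x_i(\mathbf s)/\rho_i(\mathbf s)$; these coincide for deterministic $\mathbf x$ and are then denoted $R(\boldsymbol\rho,\mathbf x)$. Relation $\prec$: consider the directed graph on $[k]^2$ with an edge $(s_1,s_2)\to(s_1',s_2)$ whenever $(s_1,s_1')\in\sigma_1(s_2)$, and an edge $(s_1,s_2')\to(s_1,s_2)$ whenever $(s_2,s_2')\in\sigma_2(s_1)$. For distinct profiles, $(s_1,s_2)\prec(s_1',s_2')$ means that there is a directed path from $(s_1,s_2)$ to $(s_1',s_2')$. Conflict function: $f(u,v)=1$ if $u=v=1$, and $f(u,v)=\frac{uv-1}{u+v-2}$ otherwise (used for $u,v\in(0,1]$ or $u,v\in[1,\infty)$). Conflict pairs: a pair $(s_1,s_2)\prec(s_1',s_2')$ is an $\alpha$-value conflict pair if $\frac1{f(\rho_2(s_1,s_2),\rho_1(s_1',s_2'))}>\alpha$; an $\alpha$-cost conflict pair if $f\left(\frac1{\rho_2(s_1,s_2)},\frac1{\rho_1(s_1',s_2')}\right)>\alpha$; an $\alpha$-deterministic conflict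 pair if $\min\left(\frac1{\rho_2(s_1,s_2)},\frac1{\rho_1(s_1',s_2')}\right)>\alpha$. *)

theory Defs
  imports Complex_Main
begin

text \<open>
  Two agents, named \<open>1\<close> and \<open>2\<close>, each with a signal in \<open>{1..k}\<close>. Families such as the values
  \<open>v\<^sub>i(s)\<close>, the ratios \<open>\<rho>\<^sub>i(s)\<close> or the allocations \<open>x\<^sub>i(s)\<close> are total functions
  \<open>nat \<Rightarrow> nat \<times> nat \<Rightarrow> real\<close>; only their values at \<open>i \<in> agents\<close>, \<open>s \<in> profiles k\<close> are meaningful.
\<close>

definition agents :: "nat set" where
  "agents = {1, 2}"

definition signals :: "nat \<Rightarrow> nat set" where
  "signals k = {1..k}"

definition profiles :: "nat \<Rightarrow> (nat \<times> nat) set" where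
  "profiles k = signals k \<times> signals k"

text \<open>The profile in which agent \<open>i\<close> has signal \<open>a\<close> and the other agent has signal \<open>b\<close>.\<close>

definition profile :: "nat \<Rightarrow> nat \<Rightarrow> nat \<Rightarrow> nat \<times> nat" where
  "profile i a b = (if i = 1 then (a, b) else (b, a))"

definition perf_ratio :: "(nat \<Rightarrow> nat \<times> nat \<Rightarrow> real) \<Rightarrow> nat \<Rightarrow> nat \<times> nat \<Rightarrow> real" where
  "perf_ratio v i s = v i s / Max ((\<lambda>j. v j s) ` agents)"

definition signal_order ::
    "nat \<Rightarrow> (nat \<Rightarrow> nat \<times> nat \<Rightarrow> real) \<Rightarrow> nat \<Rightarrow> nat \<Rightarrow> (nat \<times> nat) set" where
  "signal_order k v i b =
     {(a, a') \<in> signals k \<times> signals k. v i (profile i a b) < v i (profile i a' b)}"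

definition mono_allocs ::
    "nat \<Rightarrow> (nat \<Rightarrow> nat \<Rightarrow> (nat \<times> nat) set) \<Rightarrow> (nat \<Rightarrow> nat \<times> nat \<Rightarrow> real) set" where
  "mono_allocs k \<sigma> =
     {x. (\<forall>i\<in>agents. \<forall>s\<in>profiles k. x i s \<ge> 0) \<and>
         (\<forall>s\<in>profiles k. x 1 s + x 2 s = 1) \<and>
         (\<forall>i\<in>agents. \<forall>b\<in>signals k. \<forall>(a, a')\<in>\<sigma> i b. x i (profile i a b) \<le> x i (profile i a' b))}"

definition det_mono_allocs ::
    "nat \<Rightarrow> (nat \<Rightarrow> nat \<Rightarrow> (nat \<times> nat) set) \<Rightarrow> (nat \<Rightarrow> nat \<times> nat \<Rightarrow> real) set" where
  "det_mono_allocs k \<sigma> =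
     {x \<in> mono_allocs k \<sigma>. \<forall>i\<in>agents. \<forall>s\<in>profiles k. x i s \<in> {0, 1}}"

definition value_ratio ::
    "nat \<Rightarrow> (nat \<Rightarrow> nat \<times> nat \<Rightarrow> real) \<Rightarrow> (nat \<Rightarrow> nat \<times> nat \<Rightarrow> real) \<Rightarrow> real" where
  "value_ratio k \<rho> x = Max ((\<lambda>s. 1 / (\<Sum>i\<in>agents. x i s * \<rho> i s)) ` profiles k)"

definition cost_ratio ::
    "nat \<Rightarrow> (nat \<Rightarrow> nat \<times> nat \<Rightarrow> real) \<Rightarrow> (nat \<Rightarrow> nat \<times> nat \<Rightarrow> real) \<Rightarrow> real" where
  "cost_ratio k \<rho> x = Max ((\<lambda>s. \<Sum>i\<in>agents. x i s / \<rho> i s) ` profiles k)"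

text \<open>
  Only used for deterministic allocations, where it equals \<open>cost_ratio\<close> as well
  (lemma \<open>det_ratio_eq_cost_ratio\<close>).
\<close>

definition det_ratio ::
    "nat \<Rightarrow> (nat \<Rightarrow> nat \<times> nat \<Rightarrow> real) \<Rightarrow> (nat \<Rightarrow> nat \<times> nat \<Rightarrow> real) \<Rightarrow> real" where
  "det_ratio k \<rho> x = value_ratio k \<rho> x"

lemma det_ratio_eq_cost_ratio:
  assumes "x \<in> det_mono_allocs k \<sigma>"
  shows "det_ratio k \<rho> x = cost_ratio k \<rho> x"
proof -
  have "1 / (\<Sum>i\<in>agents. x i s * \<rho> i s) = (\<Sum>i\<in>agents. x i s / \<rho> i s)"
    if "s \<in> profiles k" for s
  proof -
    have "x 1 s + x 2 s = 1" "x 1 s = 0 \<or> x 1 s = 1"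
      using assms that by (auto simp: det_mono_allocs_def mono_allocs_def agents_def)
    then show ?thesis by (auto simp: agents_def)
  qed
  then show ?thesis
    by (simp add: det_ratio_def value_ratio_def cost_ratio_def cong: image_cong)
qed

lemma perf_ratio_cost:
  assumes "i \<in> agents" "\<And>j. j \<in> agents \<Longrightarrow> v j s > 0"
  shows "perf_ratio v i s = Min ((\<lambda>j. 1 / v j s) ` agents) / (1 / v i s)"
proof -
  have "v 1 s > 0" "v 2 s > 0" using assms(2) by (auto simp: agents_def)
  then show ?thesis
    by (auto simp: perf_ratio_def agents_def min_def max_def divide_simps)
qed

text \<open>
  Edges point in the direction in which \<open>x\<^sub>1\<close> has to grow, so agent \<open>2\<close>'s order is reversed.
\<close>

definition signal_edges ::
    "nat \<Rightarrow> (nat \<Rightarrow> nat \<Rightarrow> (nat \<times> nat) set) \<Rightarrow> ((nat \<times> nat) \<times> (nat \<times> nat)) set" where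
  "signal_edges k \<sigma> =
     {((s1, s2), (s1', s2)) | s1 s1' s2. s2 \<in> signals k \<and> (s1, s1') \<in> \<sigma> 1 s2} \<union>
     {((s1, s2'), (s1, s2)) | s1 s2 s2'. s1 \<in> signals k \<and> (s2, s2') \<in> \<sigma> 2 s1}"

definition profile_prec ::
    "nat \<Rightarrow> (nat \<Rightarrow> nat \<Rightarrow> (nat \<times> nat) set) \<Rightarrow> nat \<times> nat \<Rightarrow> nat \<times> nat \<Rightarrow> bool" where
  "profile_prec k \<sigma> s s' \<longleftrightarrow>
     s \<in> profiles k \<and> s' \<in> profiles k \<and> s \<noteq> s' \<and> (s, s') \<in> (signal_edges k \<sigma>)\<^sup>+"

definition conflict_fun :: "real \<Rightarrow> real \<Rightarrow> real" where
  "conflict_fun u w = (if u = 1 \<and> w = 1 then 1 else (u * w - 1) / (u + w - 2))"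

definition value_conflict_pair ::
    "nat \<Rightarrow> (nat \<Rightarrow> nat \<Rightarrow> (nat \<times> nat) set) \<Rightarrow> (nat \<Rightarrow> nat \<times> nat \<Rightarrow> real) \<Rightarrow> real \<Rightarrow>
      nat \<times> nat \<Rightarrow> nat \<times> nat \<Rightarrow> bool" where
  "value_conflict_pair k \<sigma> \<rho> \<alpha> s s' \<longleftrightarrow>
     profile_prec k \<sigma> s s' \<and> 1 / conflict_fun (\<rho> 2 s) (\<rho> 1 s') > \<alpha>"

definition cost_conflict_pair ::
    "nat \<Rightarrow> (nat \<Rightarrow> nat \<Rightarrow> (nat \<times> nat) set) \<Rightarrow> (nat \<Rightarrow> nat \<times> nat \<Rightarrow> real) \<Rightarrow> real \<Rightarrow>
      nat \<times> nat \<Rightarrow> nat \<times> nat \<Rightarrow> bool" where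
  "cost_conflict_pair k \<sigma> \<rho> \<alpha> s s' \<longleftrightarrow>
     profile_prec k \<sigma> s s' \<and> conflict_fun (1 / \<rho> 2 s) (1 / \<rho> 1 s') > \<alpha>"

definition det_conflict_pair ::
    "nat \<Rightarrow> (nat \<Rightarrow> nat \<Rightarrow> (nat \<times> nat) set) \<Rightarrow> (nat \<Rightarrow> nat \<times> nat \<Rightarrow> real) \<Rightarrow> real \<Rightarrow>
      nat \<times> nat \<Rightarrow> nat \<times> nat \<Rightarrow> bool" where
  "det_conflict_pair k \<sigma> \<rho> \<alpha> s s' \<longleftrightarrow>
     profile_prec k \<sigma> s s' \<and> min (1 / \<rho> 2 s) (1 / \<rho> 1 s') > \<alpha>"

end

(* For each of the three ratios, the bound \<alpha> on the ratio at a single profile s says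
   that the agent with ratio 1 receives at least l (r) of the good, where r is the ratio of the
   other agent and l is a threshold function depending only on \<alpha>.  Writing y = x_1, monotonicity
   says that y grows along the edges and the ratio bound says
   l (\<rho>_2 s) \<le> y s \<le> 1 - l (\<rho>_1 s).  Such a y exists iff no lower bound exceeds an upper bound
   that is reachable from it: take for y s the largest lower bound over all profiles from which s
   can be reached.  The three notions of conflict pair say exactly that
   l (\<rho>_2 s) + l (\<rho>_1 s') > 1. *)

theory Submission
  imports Defs
begin

section \<open>Performance ratios, and bounds on maxima taken profile by profile\<close>

lemma sum_agents: "(\<Sum>i\<in>agents. g i) = g 1 + (g 2 :: real)"
  by (simp add: agents_def)

lemma finite_profiles: "finite (profiles k)"
  by (simp add: profiles_def signals_def)

lemma profiles_nonempty: "k \<ge> 1 \<Longrightarrow> profiles k \<noteq> {}"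
  by (auto simp: profiles_def signals_def)

text \<open>The last claim holds because an agent attaining the maximum has ratio 1. It leaves at
  most one ratio below 1 at each profile.\<close>

lemma perf_ratio_bounds:
  assumes "v 1 s > 0" "v 2 s > 0"
  shows "0 < perf_ratio v 1 s" "perf_ratio v 1 s \<le> 1"
    and "0 < perf_ratio v 2 s" "perf_ratio v 2 s \<le> 1"
    and "perf_ratio v 1 s = 1 \<or> perf_ratio v 2 s = 1"
  using assms by (auto simp: perf_ratio_def agents_def max_def)

text \<open>With \<open>k \<ge> 1\<close> the set \<open>profiles k\<close> is nonempty, so
  \<open>Max\<close> is a genuine maximum and can be bounded pointwise.\<close>

lemma cost_ratio_le_iff:
  assumes "k \<ge> 1"
  shows "cost_ratio k \<rho> x \<le> \<alpha> \<longleftrightarrow>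
    (\<forall>s\<in>profiles k. x 1 s / \<rho> 1 s + x 2 s / \<rho> 2 s \<le> \<alpha>)"
  using assms by (simp add: cost_ratio_def sum_agents finite_profiles profiles_nonempty)

lemma value_ratio_le_iff:
  assumes "k \<ge> 1"
  shows "value_ratio k \<rho> x \<le> \<alpha> \<longleftrightarrow>
    (\<forall>s\<in>profiles k. 1 / (x 1 s * \<rho> 1 s + x 2 s * \<rho> 2 s) \<le> \<alpha>)"
  using assms by (simp add: value_ratio_def sum_agents finite_profiles profiles_nonempty)

section \<open>Monotone allocations with lower bounds\<close>

lemma signal_edges_profiles:
  assumes "\<And>i b. \<sigma> i b \<subseteq> signals k \<times> signals k"
    and "(s, s') \<in> signal_edges k \<sigma>"
  shows "s \<in> profiles k" "s' \<in> profiles k"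
  using assms(2) subsetD[OF assms(1)] by (fastforce simp: signal_edges_def profiles_def)+

lemma mono_allocs_edge:
  assumes sub: "\<And>i b. \<sigma> i b \<subseteq> signals k \<times> signals k"
    and x: "x \<in> mono_allocs k \<sigma>" and e: "(s, s') \<in> signal_edges k \<sigma>"
  shows "x 1 s \<le> x 1 s'"
proof -
  have mono: "x i (profile i a b) \<le> x i (profile i a' b)"
    if "i \<in> agents" "b \<in> signals k" "(a, a') \<in> \<sigma> i b" for i a a' b
    using x that unfolding mono_allocs_def by blast
  have tot: "x 1 t + x 2 t = 1" if "t \<in> profiles k" for t
    using x that by (auto simp: mono_allocs_def)
  from e consider
      (one) s1 s1' s2 where "s = (s1, s2)" "s' = (s1', s2)" "s2 \<in> signals k" "(s1, s1') \<in> \<sigma> 1 s2"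
    | (two) s1 s2 s2' where "s = (s1, s2')" "s' = (s1, s2)" "s1 \<in> signals k" "(s2, s2') \<in> \<sigma> 2 s1"
    unfolding signal_edges_def by blast
  then show ?thesis
  proof cases
    case one
    then show ?thesis using mono[of 1 s2 s1 s1'] by (simp add: agents_def profile_def)
  next
    case two
    \<comment> \<open>The edge runs against agent 2's order, so \<open>x 2\<close> falls along it
      and its complement \<open>x 1\<close> rises.\<close>
    then have "x 2 s' \<le> x 2 s"
      using mono[of 2 s1 s2 s2'] by (simp add: agents_def profile_def)
    then show ?thesis using tot signal_edges_profiles[OF sub e] by smt
  qed
qed

lemma mono_allocs_path:
  assumes "\<And>i b. \<sigma> i b \<subseteq> signals k \<times> signals k"
    and "x \<in> mono_allocs k \<sigma>" "(s, s') \<in> (signal_edges k \<sigma>)\<^sup>*"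
  shows "x 1 s \<le> x 1 s'"
  using assms(3) by induction (auto dest: mono_allocs_edge[OF assms(1,2)])

text \<open>The last conclusion, that \<open>x 1\<close> takes only values of \<open>lo\<close>,
  later makes the allocation deterministic when the lower bounds are 0 or 1. The reflexive closure
  in the separation hypothesis also covers the two bounds at a single profile.\<close>

lemma mono_allocs_exists:
  fixes lo hi :: "nat \<times> nat \<Rightarrow> real"
  assumes sub: "\<And>i b. \<sigma> i b \<subseteq> signals k \<times> signals k"
    and lo: "\<And>s. s \<in> profiles k \<Longrightarrow> 0 \<le> lo s"
    and hi: "\<And>s. s \<in> profiles k \<Longrightarrow> 0 \<le> hi s"
    and sep: "\<And>s s'. s \<in> profiles k \<Longrightarrow> s' \<in> profiles k \<Longrightarrow>
      (s, s') \<in> (signal_edges k \<sigma>)\<^sup>* \<Longrightarrow> lo s + hi s' \<le> 1"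
  obtains x where "x \<in> mono_allocs k \<sigma>"
    and "\<And>s. s \<in> profiles k \<Longrightarrow> lo s \<le> x 1 s \<and> hi s \<le> x 2 s \<and> x 1 s \<in> lo ` profiles k"
proof -
  define B where "B s = lo ` {t \<in> profiles k. (t, s) \<in> (signal_edges k \<sigma>)\<^sup>*}" for s
  define x :: "nat \<Rightarrow> nat \<times> nat \<Rightarrow> real"
    where "x i s = (if i = 1 then Max (B s) else 1 - Max (B s))" for i s
  have fin: "finite (B s)" for s
    by (simp add: B_def finite_profiles)
  have loB: "lo s \<in> B s" if "s \<in> profiles k" for s
    using that by (auto simp: B_def)
  have MaxB: "Max (B s) \<in> B s" if "s \<in> profiles k" for s
    using Max_in[OF fin] loB[OF that] by blast
  have lower: "lo s \<le> Max (B s)" if "s \<in> profiles k" for s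
    using Max_ge[OF fin loB[OF that]] .
  have upper: "Max (B s) \<le> 1 - hi s" if "s \<in> profiles k" for s
  proof -
    obtain t where "t \<in> profiles k" "(t, s) \<in> (signal_edges k \<sigma>)\<^sup>*" "Max (B s) = lo t"
      using MaxB[OF \<open>s \<in> profiles k\<close>] by (auto simp: B_def)
    then show ?thesis using sep[of t s] that by simp
  qed
  have edge: "Max (B s) \<le> Max (B s')" if e: "(s, s') \<in> signal_edges k \<sigma>" for s s'
  proof (rule Max_mono[OF _ _ fin])
    \<comment> \<open>A profile that reaches \<open>s\<close> reaches \<open>s'\<close> through the
      edge.\<close>
    show "B s \<subseteq> B s'"
      using e by (auto simp: B_def intro: rtrancl_into_rtrancl)
    show "B s \<noteq> {}"
      using loB signal_edges_profiles(1)[OF sub e] by blast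
  qed
  have edge1: "Max (B (a, b)) \<le> Max (B (a', b))"
    if "b \<in> signals k" "(a, a') \<in> \<sigma> 1 b" for a a' b
    using that by (intro edge) (auto simp: signal_edges_def)
  have edge2: "Max (B (b, a')) \<le> Max (B (b, a))"
    if "b \<in> signals k" "(a, a') \<in> \<sigma> 2 b" for a a' b
    using that by (intro edge) (auto simp: signal_edges_def)
  show thesis
  proof
    have "0 \<le> Max (B s)" "Max (B s) \<le> 1" if "s \<in> profiles k" for s
      using lower[OF that] lo[OF that] upper[OF that] hi[OF that] by linarith+
    then show "x \<in> mono_allocs k \<sigma>"
      using edge1 edge2 by (auto simp: mono_allocs_def x_def agents_def profile_def)
    show "lo s \<le> x 1 s \<and> hi s \<le> x 2 s \<and> x 1 s \<in> lo ` profiles k"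
      if "s \<in> profiles k" for s
      using lower[OF that] upper[OF that] MaxB[OF that] by (auto simp: x_def B_def)
  qed
qed

text \<open>\<open>A\<close> is either all of \<open>mono_allocs k \<sigma>\<close> or, for a \<open>{0, 1}\<close>-valued threshold, its deterministic part.\<close>

lemma mono_allocs_threshold_iff:
  fixes l :: "real \<Rightarrow> real" and \<rho> :: "nat \<Rightarrow> nat \<times> nat \<Rightarrow> real"
  assumes sub: "\<And>i b. \<sigma> i b \<subseteq> signals k \<times> signals k"
    and l: "\<And>r. 0 \<le> l r" "\<And>r. 0 < r \<Longrightarrow> r \<le> 1 \<Longrightarrow> l r \<le> 1" "l 1 = 0"
    and \<rho>: "\<And>i s. i \<in> {1, 2} \<Longrightarrow> s \<in> profiles k \<Longrightarrow> 0 < \<rho> i s \<and> \<rho> i s \<le> 1"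
      "\<And>s. s \<in> profiles k \<Longrightarrow> \<rho> 1 s = 1 \<or> \<rho> 2 s = 1"
    and A: "A \<subseteq> mono_allocs k \<sigma>"
      "\<And>x. x \<in> mono_allocs k \<sigma> \<Longrightarrow> \<forall>s\<in>profiles k. x 1 s \<in> range l \<Longrightarrow> x \<in> A"
  shows "(\<exists>x\<in>A. \<forall>s\<in>profiles k. l (\<rho> 2 s) \<le> x 1 s \<and> l (\<rho> 1 s) \<le> x 2 s) \<longleftrightarrow>
    \<not> (\<exists>s s'. profile_prec k \<sigma> s s' \<and> l (\<rho> 2 s) + l (\<rho> 1 s') > 1)"
proof
  assume "\<exists>x\<in>A. \<forall>s\<in>profiles k. l (\<rho> 2 s) \<le> x 1 s \<and> l (\<rho> 1 s) \<le> x 2 s"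
  then obtain x where x: "x \<in> mono_allocs k \<sigma>"
    and b: "\<And>s. s \<in> profiles k \<Longrightarrow> l (\<rho> 2 s) \<le> x 1 s \<and> l (\<rho> 1 s) \<le> x 2 s"
    using A(1) by blast
  have "l (\<rho> 2 s) + l (\<rho> 1 s') \<le> 1" if "profile_prec k \<sigma> s s'" for s s'
  proof -
    have s: "s \<in> profiles k" "s' \<in> profiles k" "(s, s') \<in> (signal_edges k \<sigma>)\<^sup>*"
      using that by (auto simp: profile_prec_def)
    have "x 1 s' + x 2 s' = 1" using x s by (auto simp: mono_allocs_def)
    then show ?thesis
      using b[OF s(1)] b[OF s(2)] mono_allocs_path[OF sub x s(3)] by linarith
  qed
  then show "\<not> (\<exists>s s'. profile_prec k \<sigma> s s' \<and> l (\<rho> 2 s) + l (\<rho> 1 s') > 1)"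
    by force
next
  assume no: "\<not> (\<exists>s s'. profile_prec k \<sigma> s s' \<and> l (\<rho> 2 s) + l (\<rho> 1 s') > 1)"
  have "l (\<rho> 2 s) + l (\<rho> 1 s') \<le> 1"
    if s: "s \<in> profiles k" "s' \<in> profiles k" "(s, s') \<in> (signal_edges k \<sigma>)\<^sup>*" for s s'
  proof (cases "s = s'")
    \<comment> \<open>\<open>profile_prec\<close> relates distinct profiles only. At a single
      profile one of the ratios is 1, so its threshold is 0, and the other threshold is at most
      1.\<close>
    case True
    then show ?thesis using \<rho>(1)[of 1 s] \<rho>(1)[of 2 s] \<rho>(2)[of s] l(2,3) s by force
  next
    case False
    then have "profile_prec k \<sigma> s s'" using s by (simp add: profile_prec_def rtrancl_eq_or_trancl)
    then show ?thesis using no linorder_not_less by blast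
  qed
  then obtain x where x: "x \<in> mono_allocs k \<sigma>"
    and b: "\<And>s. s \<in> profiles k \<Longrightarrow>
      l (\<rho> 2 s) \<le> x 1 s \<and> l (\<rho> 1 s) \<le> x 2 s \<and> x 1 s \<in> (\<lambda>s. l (\<rho> 2 s)) ` profiles k"
    using mono_allocs_exists[where \<sigma> = \<sigma>, OF sub,
        where lo = "\<lambda>s. l (\<rho> 2 s)" and hi = "\<lambda>s. l (\<rho> 1 s)"] l(1)
    by blast
  then show "\<exists>x\<in>A. \<forall>s\<in>profiles k. l (\<rho> 2 s) \<le> x 1 s \<and> l (\<rho> 1 s) \<le> x 2 s"
  proof (intro bexI)
    show "x \<in> A" using A(2)[OF x] b by blast
  qed (use b in blast)
qed

section \<open>Threshold functions\<close>

text \<open>An agent whose ratio \<open>r\<close> violates the bound cannot be chosen, so the other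
  agent must get everything; otherwise there is no constraint.\<close>

definition det_threshold :: "real \<Rightarrow> real \<Rightarrow> real" where
  "det_threshold \<alpha> r = (if 1 / r > \<alpha> then 1 else 0)"

text \<open>At \<open>r = 1\<close> the next two values are \<open>0\<close>: the former by the case distinction, the latter
  because \<open>x / 0 = 0\<close>.\<close>

definition cost_threshold :: "real \<Rightarrow> real \<Rightarrow> real" where
  "cost_threshold \<alpha> r = (if r = 1 then 0 else max 0 (1 - (\<alpha> - 1) / (1 / r - 1)))"

definition value_threshold :: "real \<Rightarrow> real \<Rightarrow> real" where
  "value_threshold \<alpha> r = max 0 ((1 / \<alpha> - r) / (1 - r))"

text \<open>Since \<open>x = 1 - y\<close>, the bound reads
  \<open>y * (1 / r - 1) \<le> \<alpha> - 1\<close>, which is solved for \<open>y\<close>. Cutting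
  off at 0 is harmless because \<open>x \<ge> 0\<close>. For \<open>r = 1\<close> both sides are
  true.\<close>

lemma cost_threshold_le_iff:
  assumes "\<alpha> \<ge> 1" "0 < r" "r \<le> 1" "0 \<le> x" "x + y = 1"
  shows "x + y / r \<le> \<alpha> \<longleftrightarrow> cost_threshold \<alpha> r \<le> x"
proof (cases "r = 1")
  case False
  then have "1 / r - 1 > 0" using assms by simp
  then have "y \<le> (\<alpha> - 1) / (1 / r - 1) \<longleftrightarrow> y * (1 / r - 1) \<le> \<alpha> - 1"
    by (rule pos_le_divide_eq)
  then have "1 - (\<alpha> - 1) / (1 / r - 1) \<le> x \<longleftrightarrow> y * (1 / r - 1) \<le> \<alpha> - 1"
    using assms(5) by linarith
  also have "\<dots> \<longleftrightarrow> x + y / r \<le> \<alpha>"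
    using assms(5) by (auto simp: right_diff_distrib)
  finally show ?thesis using False assms by (simp add: cost_threshold_def)
qed (use assms in \<open>simp add: cost_threshold_def\<close>)

text \<open>Taking reciprocals makes the bound linear in \<open>x\<close>. This needs
  \<open>x + y * r > 0\<close>: if \<open>x = 0\<close>, then \<open>y = 1\<close> and the sum is
  \<open>r\<close>.\<close>

lemma value_threshold_le_iff:
  assumes "\<alpha> \<ge> 1" "0 < r" "r \<le> 1" "0 \<le> x" "0 \<le> y" "x + y = 1"
  shows "1 / (x + y * r) \<le> \<alpha> \<longleftrightarrow> value_threshold \<alpha> r \<le> x"
proof -
  have pos: "x + y * r > 0"
    using assms by (cases "x = 0") (auto intro: add_pos_nonneg)
  have "1 / (x + y * r) \<le> \<alpha> \<longleftrightarrow> 1 / \<alpha> \<le> x + y * r"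
    using pos assms(1) by (simp add: pos_divide_le_eq mult.commute)
  also have "\<dots> \<longleftrightarrow> value_threshold \<alpha> r \<le> x"
  proof (cases "r = 1")
    case False
    have "(1 / \<alpha> - r) / (1 - r) \<le> x \<longleftrightarrow> 1 / \<alpha> - r \<le> x * (1 - r)"
      using False assms(3) by (intro pos_divide_le_eq) simp
    also have "\<dots> \<longleftrightarrow> 1 / \<alpha> \<le> x + (1 - x) * r"
      by (auto simp: left_diff_distrib right_diff_distrib)
    also have "1 - x = y" using assms(6) by simp
    finally show ?thesis using assms(4) by (simp add: value_threshold_def)
  qed (use assms in \<open>simp add: value_threshold_def\<close>)
  finally show ?thesis .
qed

lemma det_threshold_le_iff:
  assumes "\<alpha> \<ge> 1" "0 < r" "x \<in> {0, 1}" "x + y = 1"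
  shows "1 / (x + y * r) \<le> \<alpha> \<longleftrightarrow> det_threshold \<alpha> r \<le> x"
  using assms by (auto simp: det_threshold_def)

lemma cost_threshold_le_1:
  assumes "\<alpha> \<ge> 1" "0 < r" "r \<le> 1"
  shows "cost_threshold \<alpha> r \<le> 1"
  using assms by (simp add: cost_threshold_def)

lemma value_threshold_le_1:
  assumes "\<alpha> \<ge> 1" "0 < r" "r \<le> 1"
  shows "value_threshold \<alpha> r \<le> 1"
  using assms by (auto simp: value_threshold_def divide_le_eq_1)

text \<open>In terms of the deviations a = u - 1 and b = w - 1 the conflict function is 1 + a * b /
  (a + b), the shape to which a sum of thresholds leads.\<close>

lemma conflict_fun_alt:
  assumes "u + w \<noteq> 2"
  shows "conflict_fun u w = 1 + (u - 1) * (w - 1) / (u + w - 2)"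
proof -
  have "conflict_fun u w = (u * w - 1) / (u + w - 2)"
    using assms by (auto simp: conflict_fun_def)
  also have "u * w - 1 = (u + w - 2) + (u - 1) * (w - 1)"
    by (simp add: algebra_simps)
  finally show ?thesis using assms by (simp add: add_divide_distrib)
qed

text \<open>Links thresholds to conflicts, since 1/a + 1/b = (a + b) / (a * b). Here
  \<open>c\<close> will be \<alpha> - 1 for costs and 1 - 1/\<alpha> for values.\<close>

lemma sum_divide_less_1_iff:
  fixes a b c :: real
  assumes "a > 0" "b > 0"
  shows "c / a + c / b < 1 \<longleftrightarrow> c < a * b / (a + b)"
proof -
  have "c / a + c / b = c * (a + b) / (a * b)"
    using assms by (simp add: field_simps)
  then show ?thesis
    using assms by (simp add: pos_divide_less_eq pos_less_divide_eq)
qed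

lemma cost_threshold_conflict:
  assumes "\<alpha> \<ge> 1" "0 < p" "p \<le> 1" "0 < q" "q \<le> 1"
  shows "conflict_fun (1 / p) (1 / q) > \<alpha> \<longleftrightarrow> cost_threshold \<alpha> p + cost_threshold \<alpha> q > 1"
proof (cases "p = 1 \<or> q = 1")
  case True
  \<comment> \<open>If exactly one argument is 1, numerator and denominator agree; if both are, the
    separate clause applies.\<close>
  then have "conflict_fun (1 / p) (1 / q) = 1" by (auto simp: conflict_fun_def)
  moreover have "cost_threshold \<alpha> p + cost_threshold \<alpha> q \<le> 1"
    using True cost_threshold_le_1 assms by (auto simp: cost_threshold_def)
  ultimately show ?thesis using assms by simp
next
  case False
  define a b where "a = 1 / p - 1" and "b = 1 / q - 1"
  have ab: "a > 0" "b > 0" using False assms by (auto simp: a_def b_def)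
  have f: "conflict_fun (1 / p) (1 / q) = 1 + a * b / (a + b)"
    using ab conflict_fun_alt[of "1 / p" "1 / q"] by (simp add: a_def b_def)
  have ge: "cost_threshold \<alpha> p + cost_threshold \<alpha> q
    = max 0 (1 - (\<alpha> - 1) / a) + max 0 (1 - (\<alpha> - 1) / b)"
    using False by (simp add: cost_threshold_def a_def b_def)
  \<comment> \<open>Each threshold is at most 1, so a sum above 1 forces both to be positive and the
    cut-offs at 0 drop out.\<close>
  have "(\<alpha> - 1) / a \<ge> 0" "(\<alpha> - 1) / b \<ge> 0" using assms ab by auto
  then have "cost_threshold \<alpha> p + cost_threshold \<alpha> q > 1 \<longleftrightarrow> (\<alpha> - 1) / a + (\<alpha> - 1) / b < 1"
    unfolding ge by linarith
  also have "\<dots> \<longleftrightarrow> \<alpha> - 1 < a * b / (a + b)"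
    by (rule sum_divide_less_1_iff[OF ab])
  finally show ?thesis using f by auto
qed

lemma value_threshold_conflict:
  assumes "\<alpha> \<ge> 1" "0 < p" "p \<le> 1" "0 < q" "q \<le> 1"
  shows "1 / conflict_fun p q > \<alpha> \<longleftrightarrow> value_threshold \<alpha> p + value_threshold \<alpha> q > 1"
proof (cases "p = 1 \<or> q = 1")
  case True
  then have "conflict_fun p q = 1" by (auto simp: conflict_fun_def)
  moreover have "value_threshold \<alpha> p + value_threshold \<alpha> q \<le> 1"
    using True value_threshold_le_1 assms by (auto simp: value_threshold_def)
  ultimately show ?thesis using assms by simp
next
  case False
  \<comment> \<open>This \<open>c\<close> gives the threshold of \<open>p\<close> the form 1 - c/a
    before the cut-off, and turns f < 1/\<alpha> into c < a * b / (a + b) for the conflict function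
    f.\<close>
  define a b c where "a = 1 - p" and "b = 1 - q" and "c = 1 - 1 / \<alpha>"
  have ab: "a > 0" "b > 0" "a < 1" "b < 1" "c \<ge> 0"
    using False assms by (auto simp: a_def b_def c_def)
  have f: "conflict_fun p q = 1 - a * b / (a + b)"
  proof -
    \<comment> \<open>Both deviations are negative here: their product is a * b, their sum -(a +
      b).\<close>
    have "(p - 1) * (q - 1) / (p + q - 2) = - (a * b / (a + b))"
      unfolding minus_divide_right
      by (rule arg_cong2[where f = "(/)"]) (auto simp: a_def b_def algebra_simps)
    then show ?thesis using ab conflict_fun_alt[of p q] by (simp add: a_def b_def)
  qed
  \<comment> \<open>Gives positivity of the conflict function, needed to invert the inequality with
    \<alpha>.\<close>
  have "a * b < a + b" using ab mult_strict_right_mono[of a 1 b] by linarith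
  then have "conflict_fun p q > 0" using f ab(1,2) by simp
  then have "1 / conflict_fun p q > \<alpha> \<longleftrightarrow> conflict_fun p q < 1 / \<alpha>"
    using assms(1) by (simp add: pos_less_divide_eq mult.commute)
  also have "\<dots> \<longleftrightarrow> c < a * b / (a + b)"
    unfolding f c_def by linarith
  also have "\<dots> \<longleftrightarrow> c / a + c / b < 1"
    by (rule sum_divide_less_1_iff[OF ab(1,2), symmetric])
  also have "\<dots> \<longleftrightarrow> value_threshold \<alpha> p + value_threshold \<alpha> q > 1"
  proof -
    have "value_threshold \<alpha> p = max 0 (1 - c / a)" "value_threshold \<alpha> q = max 0 (1 - c / b)"
      using ab by (simp_all add: value_threshold_def a_def b_def c_def field_simps)
    moreover have "c / a \<ge> 0" "c / b \<ge> 0" using ab by auto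
    ultimately show ?thesis by linarith
  qed
  finally show ?thesis .
qed

lemma det_threshold_conflict:
  "min (1 / p) (1 / q) > \<alpha> \<longleftrightarrow> det_threshold \<alpha> p + det_threshold \<alpha> q > 1"
  by (auto simp: det_threshold_def)

section \<open>The characterization\<close>

theorem lemma4p15:
  fixes k :: nat and v :: "nat \<Rightarrow> nat \<times> nat \<Rightarrow> real" and \<alpha> :: real
    and \<rho> :: "nat \<Rightarrow> nat \<times> nat \<Rightarrow> real" and \<sigma> :: "nat \<Rightarrow> nat \<Rightarrow> (nat \<times> nat) set"
  assumes "k \<ge> 1"
    and "\<And>i s. i \<in> agents \<Longrightarrow> s \<in> profiles k \<Longrightarrow> v i s > 0"
    and "\<alpha> \<ge> 1"
  defines "\<rho> \<equiv> perf_ratio v" and "\<sigma> \<equiv> signal_order k v"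
  shows "((\<exists>x \<in> det_mono_allocs k \<sigma>. det_ratio k \<rho> x \<le> \<alpha>) \<longleftrightarrow>
           \<not> (\<exists>s s'. det_conflict_pair k \<sigma> \<rho> \<alpha> s s')) \<and>
         ((\<exists>x \<in> mono_allocs k \<sigma>. cost_ratio k \<rho> x \<le> \<alpha>) \<longleftrightarrow>
           \<not> (\<exists>s s'. cost_conflict_pair k \<sigma> \<rho> \<alpha> s s')) \<and>
         ((\<exists>x \<in> mono_allocs k \<sigma>. value_ratio k \<rho> x \<le> \<alpha>) \<longleftrightarrow>
           \<not> (\<exists>s s'. value_conflict_pair k \<sigma> \<rho> \<alpha> s s'))"
proof -
  have sub: "\<sigma> i b \<subseteq> signals k \<times> signals k" for i b
    by (auto simp: \<sigma>_def signal_order_def)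
  have v: "v 1 s > 0" "v 2 s > 0" if "s \<in> profiles k" for s
    using assms(2) that by (auto simp: agents_def)
  have \<rho>: "0 < \<rho> i s \<and> \<rho> i s \<le> 1" if "i \<in> {1, 2}" "s \<in> profiles k" for i s
    using perf_ratio_bounds[of v s] v that by (auto simp: \<rho>_def)
  have \<rho>1: "\<rho> 1 s = 1 \<or> \<rho> 2 s = 1" if "s \<in> profiles k" for s
    using perf_ratio_bounds[of v s] v that by (auto simp: \<rho>_def)
  have prec: "s \<in> profiles k" "s' \<in> profiles k" if "profile_prec k \<sigma> s s'" for s s'
    using that by (auto simp: profile_prec_def)
  have alloc: "0 \<le> x 1 s" "0 \<le> x 2 s" "x 1 s + x 2 s = 1"
    if "x \<in> mono_allocs k \<sigma>" "s \<in> profiles k" for x s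
    using that by (auto simp: mono_allocs_def agents_def)

  \<comment> \<open>One of the two ratios is 1. The threshold of the other expresses the bound,
    while the second inequality is trivial as the threshold of 1 is 0. The same argument serves
    values and deterministic allocations below.\<close>
  have "x 1 s / \<rho> 1 s + x 2 s / \<rho> 2 s \<le> \<alpha> \<longleftrightarrow>
      cost_threshold \<alpha> (\<rho> 2 s) \<le> x 1 s \<and> cost_threshold \<alpha> (\<rho> 1 s) \<le> x 2 s"
    if x: "x \<in> mono_allocs k \<sigma>" and s: "s \<in> profiles k" for x s
    using \<rho>1[OF s] alloc[OF x s] \<rho>[OF _ s, of 1] \<rho>[OF _ s, of 2]
      cost_threshold_le_iff[of \<alpha> "\<rho> 2 s" "x 1 s" "x 2 s"]
      cost_threshold_le_iff[of \<alpha> "\<rho> 1 s" "x 2 s" "x 1 s"]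
      \<open>\<alpha> \<ge> 1\<close>
    by (auto simp: cost_threshold_def[of \<alpha> 1] add.commute)
  then have "(\<exists>x \<in> mono_allocs k \<sigma>. cost_ratio k \<rho> x \<le> \<alpha>) \<longleftrightarrow>
      (\<exists>x \<in> mono_allocs k \<sigma>. \<forall>s\<in>profiles k.
        cost_threshold \<alpha> (\<rho> 2 s) \<le> x 1 s \<and> cost_threshold \<alpha> (\<rho> 1 s) \<le> x 2 s)"
    using \<open>k \<ge> 1\<close> by (simp add: cost_ratio_le_iff)
  also have "\<dots> \<longleftrightarrow> \<not> (\<exists>s s'. profile_prec k \<sigma> s s' \<and>
      cost_threshold \<alpha> (\<rho> 2 s) + cost_threshold \<alpha> (\<rho> 1 s') > 1)"
    by (rule mono_allocs_threshold_iff[OF sub _ _ _ \<rho> \<rho>1])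
      (use \<open>\<alpha> \<ge> 1\<close> in \<open>auto simp: cost_threshold_le_1, auto simp: cost_threshold_def\<close>)
  \<comment> \<open>The conflict equivalence assumes ratios in (0, 1]; \<open>profile_prec\<close>
    ensures this by placing both profiles in \<open>profiles k\<close>.\<close>
  also have "\<dots> \<longleftrightarrow> \<not> (\<exists>s s'. cost_conflict_pair k \<sigma> \<rho> \<alpha> s s')"
    using prec \<rho> \<open>\<alpha> \<ge> 1\<close>
    by (simp add: cost_conflict_pair_def cost_threshold_conflict cong: conj_cong)
  finally have cost: "(\<exists>x \<in> mono_allocs k \<sigma>. cost_ratio k \<rho> x \<le> \<alpha>) \<longleftrightarrow>
      \<not> (\<exists>s s'. cost_conflict_pair k \<sigma> \<rho> \<alpha> s s')" .

  have "1 / (x 1 s * \<rho> 1 s + x 2 s * \<rho> 2 s) \<le> \<alpha> \<longleftrightarrow>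
      value_threshold \<alpha> (\<rho> 2 s) \<le> x 1 s \<and> value_threshold \<alpha> (\<rho> 1 s) \<le> x 2 s"
    if x: "x \<in> mono_allocs k \<sigma>" and s: "s \<in> profiles k" for x s
    using \<rho>1[OF s] alloc[OF x s] \<rho>[OF _ s, of 1] \<rho>[OF _ s, of 2]
      value_threshold_le_iff[of \<alpha> "\<rho> 2 s" "x 1 s" "x 2 s"]
      value_threshold_le_iff[of \<alpha> "\<rho> 1 s" "x 2 s" "x 1 s"]
      \<open>\<alpha> \<ge> 1\<close>
    by (auto simp: value_threshold_def[of \<alpha> 1] add.commute)
  then have "(\<exists>x \<in> mono_allocs k \<sigma>. value_ratio k \<rho> x \<le> \<alpha>) \<longleftrightarrow>
      (\<exists>x \<in> mono_allocs k \<sigma>. \<forall>s\<in>profiles k.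
        value_threshold \<alpha> (\<rho> 2 s) \<le> x 1 s \<and> value_threshold \<alpha> (\<rho> 1 s) \<le> x 2 s)"
    using \<open>k \<ge> 1\<close> by (simp add: value_ratio_le_iff)
  also have "\<dots> \<longleftrightarrow> \<not> (\<exists>s s'. profile_prec k \<sigma> s s' \<and>
      value_threshold \<alpha> (\<rho> 2 s) + value_threshold \<alpha> (\<rho> 1 s') > 1)"
    by (rule mono_allocs_threshold_iff[OF sub _ _ _ \<rho> \<rho>1])
      (use \<open>\<alpha> \<ge> 1\<close> in \<open>auto simp: value_threshold_le_1, auto simp: value_threshold_def\<close>)
  also have "\<dots> \<longleftrightarrow> \<not> (\<exists>s s'. value_conflict_pair k \<sigma> \<rho> \<alpha> s s')"
    using prec \<rho> \<open>\<alpha> \<ge> 1\<close>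
    by (simp add: value_conflict_pair_def value_threshold_conflict cong: conj_cong)
  finally have val: "(\<exists>x \<in> mono_allocs k \<sigma>. value_ratio k \<rho> x \<le> \<alpha>) \<longleftrightarrow>
      \<not> (\<exists>s s'. value_conflict_pair k \<sigma> \<rho> \<alpha> s s')" .

  have "1 / (x 1 s * \<rho> 1 s + x 2 s * \<rho> 2 s) \<le> \<alpha> \<longleftrightarrow>
      det_threshold \<alpha> (\<rho> 2 s) \<le> x 1 s \<and> det_threshold \<alpha> (\<rho> 1 s) \<le> x 2 s"
    if x: "x \<in> det_mono_allocs k \<sigma>" and s: "s \<in> profiles k" for x s
  proof -
    have "x \<in> mono_allocs k \<sigma>" "x 1 s \<in> {0, 1}" "x 2 s \<in> {0, 1}"
      using x s by (auto simp: det_mono_allocs_def agents_def)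
    then show ?thesis
      using \<rho>1[OF s] alloc[OF _ s, of x] \<rho>[OF _ s, of 1] \<rho>[OF _ s, of 2]
        det_threshold_le_iff[of \<alpha> "\<rho> 2 s" "x 1 s" "x 2 s"]
        det_threshold_le_iff[of \<alpha> "\<rho> 1 s" "x 2 s" "x 1 s"]
        \<open>\<alpha> \<ge> 1\<close>
      by (auto simp: det_threshold_def[of \<alpha> 1] add.commute)
  qed
  then have "(\<exists>x \<in> det_mono_allocs k \<sigma>. det_ratio k \<rho> x \<le> \<alpha>) \<longleftrightarrow>
      (\<exists>x \<in> det_mono_allocs k \<sigma>. \<forall>s\<in>profiles k.
        det_threshold \<alpha> (\<rho> 2 s) \<le> x 1 s \<and> det_threshold \<alpha> (\<rho> 1 s) \<le> x 2 s)"
    using \<open>k \<ge> 1\<close> by (simp add: det_ratio_def value_ratio_le_iff)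
  also have "\<dots> \<longleftrightarrow> \<not> (\<exists>s s'. profile_prec k \<sigma> s s' \<and>
      det_threshold \<alpha> (\<rho> 2 s) + det_threshold \<alpha> (\<rho> 1 s') > 1)"
  proof (rule mono_allocs_threshold_iff[OF sub _ _ _ \<rho> \<rho>1])
    \<comment> \<open>The range of the threshold lies in {0, 1}, so \<open>x 1\<close> is 0 or 1 at
      each profile, and so is its complement \<open>x 2\<close>.\<close>
    fix x assume x: "x \<in> mono_allocs k \<sigma>" and "\<forall>s\<in>profiles k. x 1 s \<in> range (det_threshold \<alpha>)"
    then have "x 1 s = 0 \<or> x 1 s = 1" if "s \<in> profiles k" for s
      using that by (force simp: det_threshold_def)
    then show "x \<in> det_mono_allocs k \<sigma>"
      using x alloc(3)[OF x] by (force simp: det_mono_allocs_def agents_def)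
  qed (use \<open>\<alpha> \<ge> 1\<close> in \<open>auto simp: det_threshold_def det_mono_allocs_def\<close>)
  also have "\<dots> \<longleftrightarrow> \<not> (\<exists>s s'. det_conflict_pair k \<sigma> \<rho> \<alpha> s s')"
    by (simp only: det_conflict_pair_def det_threshold_conflict)
  finally show ?thesis using cost val by blast
qed

end
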